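(* Let $Q(x,y)=\alpha x^2+\beta xy+\gamma y^2$ be a primitive positive definite integral binary quadratic form. Let $N\ge 3$ be an integer, let $B\ge1$, and suppose $A\subseteq[N]^2$ satisfies $R_{A,Q}(m)\le B$ for every integer $m\ge1$. Then there exists a constant $c_Q>0$, depending only on $Q$, such that $$|A|\ll_Q\sqrt{B}\,N\exp\left(-c_Q\frac{\log N}{\log\log N}\right).$$
   Context: $[N]^2=\{1,\ldots,N\}^2$. For $A\subseteq[N]^2$ and $m\ge1$, $R_{A,Q}(m):=\#\{(a,b)\in A^2: a\ne b,\ Q(a-b)=m\}$. Integral means $\alpha,\beta,\gamma\in\mathbb Z$; primitive means $\gcd(\alpha,\beta,\gamma)=1$. $X\ll_Q Y$ means $X\le CY$ with $C>0$ depending only on $Q$. The constants are independent of $N$, $A$ and $B$. *)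

theory Defs
  imports Complex_Main "HOL-Library.Product_Plus"
begin

text \<open>The coefficients are integers, but the arguments range over any commutative ring, so that the
  same form can be evaluated at real vectors (for definiteness) and at integer vectors.\<close>

definition bqf :: "int \<Rightarrow> int \<Rightarrow> int \<Rightarrow> 'a \<times> 'a \<Rightarrow> 'a::comm_ring_1" where
  "bqf \<alpha> \<beta> \<gamma> v =
     of_int \<alpha> * (fst v)\<^sup>2 + of_int \<beta> * fst v * snd v + of_int \<gamma> * (snd v)\<^sup>2"

definition primitive_bqf :: "int \<Rightarrow> int \<Rightarrow> int \<Rightarrow> bool" where
  "primitive_bqf \<alpha> \<beta> \<gamma> \<longleftrightarrow> Gcd {\<alpha>, \<beta>, \<gamma>} = 1"

definition pos_def_bqf :: "int \<Rightarrow> int \<Rightarrow> int \<Rightarrow> bool" where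
  "pos_def_bqf \<alpha> \<beta> \<gamma> \<longleftrightarrow> (\<forall>v :: real \<times> real. v \<noteq> 0 \<longrightarrow> bqf \<alpha> \<beta> \<gamma> v > 0)"

definition grid :: "nat \<Rightarrow> (int \<times> int) set" where
  "grid N = {1..int N} \<times> {1..int N}"

text \<open>Ordered pairs are counted. The count is only meaningful for finite \<open>A\<close>, since \<open>card\<close>
  of an infinite set is 0.\<close>

definition rep_count :: "int \<Rightarrow> int \<Rightarrow> int \<Rightarrow> (int \<times> int) set \<Rightarrow> int \<Rightarrow> nat" where
  "rep_count \<alpha> \<beta> \<gamma> A m =
     card {(a, b). a \<in> A \<and> b \<in> A \<and> a \<noteq> b \<and> bqf \<alpha> \<beta> \<gamma> (a - b) = m}"

end

theory Submission
  imports Defs "HOL-Computational_Algebra.Primes" "HOL-Library.FuncSet" "HOL-Analysis.Convex"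
    "HOL-Real_Asymp.Real_Asymp"
begin

text \<open>
  Counting all pairs of \<open>A\<close> against the \<open>O(N\<^sup>2)\<close> possible values of \<open>Q\<close> gives only
  \<open>|A| \<lless> sqrt B * N\<close>. The saving comes from counting only pairs with \<open>q dvd Q(a - b)\<close> for a product
  \<open>q = p\<^sub>1 \<cdots> p\<^sub>k\<close> of primes that split for \<open>Q\<close>: modulo such a prime \<open>p\<close> the form \<open>Q\<close> is, up to a unit,
  a product \<open>f\<^sub>p g\<^sub>p\<close> of two independent linear forms. For each choice of one of the two forms at every
  prime, a difference killed by all chosen forms is a coincidence in a set of \<open>q\<close> residue vectors, so
  Cauchy--Schwarz yields at least \<open>|A|\<^sup>2 / q\<close> pairs. There are \<open>2\<^sup>k\<close> choices. On the other hand the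
  values \<open>m \<le> M = O(N\<^sup>2)\<close> of \<open>Q\<close> divisible by \<open>q\<close> number only \<open>M / q\<close>, and a pair is counted for
  several choices only if some \<open>p\<close> kills both forms, which forces \<open>p\<^sup>2 dvd Q(a - b)\<close> and is rare: on
  average over \<open>m\<close> this costs a factor \<open>\<Prod>(1 + 1/p) \<le> (4/3)\<^sup>k\<close>. Since each \<open>m\<close> has at most \<open>B\<close>
  representations, and the diagonal contributes \<open>2\<^sup>k |A|\<close>,
  \<open>|A|\<^sup>2 \<le> q |A| + B M (2/3)\<^sup>k\<close>  (\<open>card_sq_le_of_split_primes\<close>).

  It remains to find \<open>k\<close> of order \<open>ln N / ln ln N\<close> such primes with \<open>q \<le> sqrt N\<close>, so about
  \<open>X / ln X\<close> split primes of size \<open>X\<^bsup>O(1)\<^esup>\<close> for \<open>X = ln N\<close>. With \<open>D = \<beta>\<^sup>2 - 4\<alpha>\<gamma> < 0\<close> and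
  \<open>E = |D| (2\<alpha>)\<^sup>2\<close>, all prime divisors of \<open>1 + E n\<^sup>2\<close> split
  (\<open>bqf_splits_mod_prime\<close>), and there are many of them for \<open>n \<le> X\<close>: a prime power divides \<open>1 + E n\<^sup>2\<close> for at most two classes of \<open>n\<close>, so the
  \<open>p\<close>-part of \<open>\<Prod>n\<le>X. 1 + E n\<^sup>2\<close> exceeds that of \<open>(X!)\<^sup>2\<close> by at most a factor \<open>(1 + E X\<^sup>2)\<^sup>2\<close>, while the
  product itself exceeds \<open>(X!)\<^sup>2\<close> by the factor \<open>E\<^sup>X\<close>. Hence at least \<open>X ln E / (2 ln (1 + E X\<^sup>2))\<close>
  primes occur (\<open>power_le_power_card_quadratic_primes\<close>).
\<close>

section \<open>Many primes divide the values of a quadratic polynomial\<close>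

lemma card_multiples:
  fixes M X :: nat
  assumes "M > 0"
  shows "card {n \<in> {1..X}. M dvd n} = X div M"
proof -
  have "{n \<in> {1..X}. M dvd n} = (\<lambda>j. M * j) ` {1..X div M}"
  proof (intro equalityI subsetI)
    fix n assume n: "n \<in> {n \<in> {1..X}. M dvd n}"
    then obtain j where j: "n = M * j" by auto
    with n assms have "j \<in> {1..X div M}"
      by (auto simp: less_eq_div_iff_mult_less_eq mult.commute intro: Suc_leI gr0I)
    with j show "n \<in> (\<lambda>j. M * j) ` {1..X div M}" by blast
  next
    fix n assume "n \<in> (\<lambda>j. M * j) ` {1..X div M}"
    then obtain j where j: "n = M * j" "j \<in> {1..X div M}" by (rule imageE)
    have "M * j \<le> M * (X div M)" using j(2) by simp
    also have "\<dots> \<le> X" by (rule times_div_less_eq_dividend)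
    finally have "M * j \<le> X" .
    with j assms show "n \<in> {n \<in> {1..X}. M dvd n}" by simp
  qed
  also have "card \<dots> = X div M"
    using assms by (subst card_image) (auto simp: inj_on_def)
  finally show ?thesis .
qed

lemma card_residue_class_le:
  fixes M X :: nat
  shows "card {n \<in> {1..X}. n mod M = r} \<le> X div M + 1"
proof -
  have "inj_on (\<lambda>n. n div M) {n \<in> {1..X}. n mod M = r}"
    by (rule inj_onI) (metis (mono_tags, lifting) div_mult_mod_eq mem_Collect_eq)
  moreover have "(\<lambda>n. n div M) ` {n \<in> {1..X}. n mod M = r} \<subseteq> {0..X div M}"
    by (auto intro: div_le_mono)
  ultimately have "card {n \<in> {1..X}. n mod M = r} \<le> card {0..X div M}"
    by (intro card_inj_on_le) auto
  then show ?thesis by simp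
qed

text \<open>If \<open>n\<close> and \<open>a\<close> are two roots modulo \<open>p\<^sup>k\<close>, then \<open>p\<^sup>k dvd E (n - a) (n + a)\<close>. A root is coprime to \<open>p\<close>,
  and \<open>p\<close> is odd because \<open>E\<close> is even; so \<open>p\<close> cannot divide both \<open>n - a\<close> and \<open>n + a\<close>, and \<open>n\<close> lies in
  one of the two classes of \<open>\<plusminus>a\<close>. The bound is stated in terms of the multiples of
  \<open>p\<^sup>k\<close> because these, summed over \<open>k\<close>, give the exponent of \<open>p\<close> in \<open>X!\<close>.\<close>

lemma card_quadratic_roots_le:
  fixes E X k p :: nat
  assumes p: "prime p" and E: "even E" and k: "k \<ge> 1"
  shows "card {n \<in> {1..X}. p ^ k dvd 1 + E * n\<^sup>2} \<le> 2 * card {n \<in> {1..X}. p ^ k dvd n} + 2"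
proof (cases "\<exists>a \<in> {1..X}. p ^ k dvd 1 + E * a\<^sup>2")
  case False
  then have "{n \<in> {1..X}. p ^ k dvd 1 + E * n\<^sup>2} = {}" by auto
  then show ?thesis by (metis card.empty zero_le)
next
  case True
  then obtain a where a: "p ^ k dvd 1 + E * a\<^sup>2" by auto
  define M where "M = p ^ k"
  define b where "b = nat ((- int a) mod int M)"
  have M: "M > 0" using p by (simp add: M_def prime_gt_0_nat)
  have pd: "p dvd 1 + E * n\<^sup>2" if "M dvd 1 + E * n\<^sup>2" for n
    using that k dvd_trans[of p M] by (auto simp: M_def intro: dvd_power)
  have unit: "\<not> p dvd 2 * E * n" if "M dvd 1 + E * n\<^sup>2" for n
  proof
    assume "p dvd 2 * E * n"
    then consider "p dvd 2" | "p dvd E" | "p dvd n"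
      using p by (auto simp: prime_dvd_mult_iff)
    then have "p dvd E * n\<^sup>2"
    proof cases
      case 1
      then have "p dvd E" using E dvd_trans by blast
      then show ?thesis by simp
    qed (auto simp: power2_eq_square)
    with pd[OF that] have "p dvd 1" using dvd_add_left_iff by blast
    with p show False by (simp add: prime_gt_1_nat)
  qed
  have "n mod M = a mod M \<or> n mod M = b" if n: "M dvd 1 + E * n\<^sup>2" for n
  proof -
    have "int M dvd int (1 + E * n\<^sup>2) - int (1 + E * a\<^sup>2)"
      using n a unfolding M_def by (intro dvd_diff) (simp_all only: int_dvd_int_iff)
    also have "\<dots> = int E * ((int n - int a) * (int n + int a))"
      by (simp add: algebra_simps power2_eq_square)
    finally have *: "int M dvd int E * ((int n - int a) * (int n + int a))" .
    have ip: "prime (int p)" using p by simp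
    have cE: "coprime (int M) (int E)"
      using unit[OF n] p ip
      unfolding M_def by (auto simp: coprime_power_left_iff intro!: prime_imp_coprime)
    from * cE have *: "int M dvd (int n - int a) * (int n + int a)"
      by (simp add: coprime_dvd_mult_right_iff)
    have "\<not> (int p dvd int n - int a \<and> int p dvd int n + int a)"
    proof
      assume "int p dvd int n - int a \<and> int p dvd int n + int a"
      then have "int p dvd (int n - int a) + (int n + int a)" using dvd_add by blast
      then have "int p dvd int (2 * n)" by simp
      then have "p dvd 2 * n" by (simp only: int_dvd_int_iff)
      with unit[OF n] show False by (metis dvd_mult2 mult.commute mult.left_commute)
    qed
    then have "coprime (int p) (int n - int a) \<or> coprime (int p) (int n + int a)"
      using prime_imp_coprime[OF ip, of "int n - int a"] prime_imp_coprime[OF ip, of "int n + int a"]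
      by argo
    then have "coprime (int M) (int n - int a) \<or> coprime (int M) (int n + int a)"
      unfolding M_def of_nat_power by (elim disjE) (simp_all del: of_nat_power)
    then consider "coprime (int M) (int n - int a)" | "coprime (int M) (int n + int a)" by argo
    then have "int M dvd int n - int a \<or> int M dvd int n + int a"
      using * by cases (auto simp: coprime_dvd_mult_right_iff coprime_dvd_mult_left_iff)
    then show ?thesis
    proof
      assume "int M dvd int n - int a"
      then have "int n mod int M = int a mod int M" by (simp add: mod_eq_dvd_iff)
      then show ?thesis by (metis of_nat_eq_iff zmod_int)
    next
      assume "int M dvd int n + int a"
      then have "int n mod int M = (- int a) mod int M" by (simp add: mod_eq_dvd_iff)
      then show ?thesis unfolding b_def by (metis nat_int zmod_int)
    qed
  qed
  then have "{n \<in> {1..X}. M dvd 1 + E * n\<^sup>2} \<subseteq>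
      {n \<in> {1..X}. n mod M = a mod M} \<union> {n \<in> {1..X}. n mod M = b}" by auto
  then have "card {n \<in> {1..X}. M dvd 1 + E * n\<^sup>2} \<le>
      card ({n \<in> {1..X}. n mod M = a mod M} \<union> {n \<in> {1..X}. n mod M = b})"
    by (intro card_mono) auto
  also have "\<dots> \<le> card {n \<in> {1..X}. n mod M = a mod M} + card {n \<in> {1..X}. n mod M = b}"
    by (rule card_Un_le)
  also have "\<dots> \<le> 2 * (X div M) + 2"
    using card_residue_class_le[of X M "a mod M"] card_residue_class_le[of X M b] by linarith
  finally show ?thesis unfolding M_def[symmetric] card_multiples[OF M] .
qed

text \<open>Double counting of the pairs \<open>(n, k)\<close> with \<open>p\<^sup>k dvd f n\<close>; the bound \<open>f n < p\<^sup>K\<^sup>+\<^sup>1\<close> confines \<open>k\<close> to \<open>{1..K}\<close>.\<close>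

lemma sum_multiplicity_eq_sum_card:
  fixes f :: "nat \<Rightarrow> nat" and p K :: nat
  assumes p: "prime p" and S: "finite S"
    and pos: "\<And>n. n \<in> S \<Longrightarrow> f n > 0" and K: "\<And>n. n \<in> S \<Longrightarrow> f n < p ^ (K + 1)"
  shows "(\<Sum>n\<in>S. multiplicity p (f n)) = (\<Sum>k\<in>{1..K}. card {n \<in> S. p ^ k dvd f n})"
proof -
  have "(\<Sum>n\<in>S. multiplicity p (f n)) = (\<Sum>n\<in>S. card {k \<in> {1..K}. p ^ k dvd f n})"
  proof (rule sum.cong)
    fix n assume n: "n \<in> S"
    have dvd_iff: "p ^ k dvd f n \<longleftrightarrow> k \<le> multiplicity p (f n)" for k
      using pos[OF n] p by (intro power_dvd_iff_le_multiplicity) (auto simp: prime_gt_1_nat)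
    have "p ^ multiplicity p (f n) \<le> f n"
      using pos[OF n] by (intro dvd_imp_le multiplicity_dvd)
    also have "\<dots> < p ^ (K + 1)" by (rule K[OF n])
    finally have "multiplicity p (f n) < K + 1"
      using p by (meson power_less_imp_less_exp prime_gt_1_nat)
    then have "{k \<in> {1..K}. p ^ k dvd f n} = {1..multiplicity p (f n)}"
      by (auto simp: dvd_iff)
    then show "multiplicity p (f n) = card {k \<in> {1..K}. p ^ k dvd f n}" by simp
  qed simp
  also have "\<dots> = (\<Sum>k\<in>{1..K}. card {n \<in> S. p ^ k dvd f n})"
    by (rule sum_multicount_gen) (use S in auto)
  finally show ?thesis .
qed

lemma prod_powers_multiplicity_le:
  fixes P :: "nat set" and F :: nat
  assumes P: "finite P" "\<And>p. p \<in> P \<Longrightarrow> prime p" and F: "F > 0"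
  shows "(\<Prod>p\<in>P. p ^ multiplicity p F) \<le> F"
proof -
  have "(\<Prod>p\<in>P. p ^ multiplicity p F) = (\<Prod>p\<in>P \<inter> prime_factors F. p ^ multiplicity p F)"
    using P F by (intro prod.mono_neutral_right)
      (auto simp: prime_factors_multiplicity prime_multiplicity_gt_zero_iff)
  also have "\<dots> \<le> (\<Prod>p\<in>prime_factors F. p ^ multiplicity p F)"
    using F by (intro dvd_imp_le prod_dvd_prod_subset)
      (auto intro!: prod_pos simp: prime_gt_0_nat in_prime_factors_imp_prime)
  also have "\<dots> = F" using F by (simp add: prod_prime_factors)
  finally show ?thesis .
qed

definition quadratic_primes :: "nat \<Rightarrow> nat \<Rightarrow> nat set" where
  "quadratic_primes E X = {p. prime p \<and> (\<exists>n\<in>{1..X}. p dvd 1 + E * n\<^sup>2)}"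

lemma quadratic_primes_le:
  "p \<in> quadratic_primes E X \<Longrightarrow> p \<le> 1 + E * X\<^sup>2"
proof -
  assume "p \<in> quadratic_primes E X"
  then obtain n where n: "n \<in> {1..X}" "p dvd 1 + E * n\<^sup>2" by (auto simp: quadratic_primes_def)
  then have "p \<le> 1 + E * n\<^sup>2" by (intro dvd_imp_le) auto
  also have "\<dots> \<le> 1 + E * X\<^sup>2" using n by (auto intro!: mult_left_mono power_mono)
  finally show ?thesis .
qed

lemma finite_quadratic_primes: "finite (quadratic_primes E X)"
  by (rule finite_subset[of _ "{..1 + E * X\<^sup>2}"]) (auto dest: quadratic_primes_le)

text \<open>Compare \<open>H = \<Prod>n\<le>X. 1 + E n\<^sup>2\<close> with \<open>(X!)\<^sup>2\<close>. From below, \<open>H \<ge> E\<^sup>X (X!)\<^sup>2\<close> factor by factor. From above,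
  the root count bounds the exponent of \<open>p\<close> in \<open>H\<close> by twice its exponent in \<open>X!\<close> plus \<open>2K\<close>,
  where \<open>p\<^sup>K \<le> 1 + E X\<^sup>2\<close>; each of the primes that occur therefore contributes an excess of at most
  \<open>(1 + E X\<^sup>2)\<^sup>2\<close>.\<close>

lemma power_le_power_card_quadratic_primes:
  fixes E X :: nat
  assumes E: "even E" "E > 0"
  shows "E ^ X \<le> (1 + E * X\<^sup>2) ^ (2 * card (quadratic_primes E X))"
proof -
  define h where "h = (\<lambda>n::nat. 1 + E * n\<^sup>2)"
  define P where "P = quadratic_primes E X"
  define H where "H = (\<Prod>n=1..X. h n)"
  have H0: "H > 0" by (auto simp: H_def h_def)
  have h_mono: "h n \<le> h X" if "n \<in> {1..X}" for n
    using that by (auto simp: h_def intro!: mult_left_mono power_mono)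
  have n_le: "n \<le> h X" if "n \<in> {1..X}" for n
  proof -
    have "n * 1 \<le> n\<^sup>2 * E" unfolding power2_eq_square using that E by (intro mult_mono) auto
    then have "n \<le> h n" by (simp add: h_def mult.commute)
    with h_mono[OF that] show ?thesis by simp
  qed
  have finP: "finite P" unfolding P_def by (rule finite_quadratic_primes)
  have primeP: "prime p" if "p \<in> P" for p using that by (auto simp: P_def quadratic_primes_def)
  have pf: "prime_factors H = P"
    unfolding H_def P_def quadratic_primes_def h_def
    by (simp add: prime_factors_dvd prime_dvd_prod_iff cong: conj_cong)
  have local_bound: "p ^ multiplicity p H \<le> (p ^ multiplicity p (fact X)) ^ 2 * h X ^ 2"
    if "p \<in> P" for p
  proof -
    have p: "prime p" using primeP[OF that] .
    have "p \<ge> 2" using p by (rule prime_ge_2_nat)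
    moreover have "h X \<ge> 1" by (simp add: h_def)
    ultimately obtain K where K: "p ^ K \<le> h X" "h X < p ^ (K + 1)" using ex_power_ivl1 by blast
    have h_less: "h n < p ^ (K + 1)" and n_less: "n < p ^ (K + 1)" if "n \<in> {1..X}" for n
      using h_mono[OF that] n_le[OF that] K(2) by linarith+
    have "multiplicity p H = (\<Sum>n\<in>{1..X}. multiplicity p (h n))"
      unfolding H_def using p by (intro prime_elem_multiplicity_prod_distrib) (auto simp: h_def)
    also have "\<dots> = (\<Sum>k\<in>{1..K}. card {n \<in> {1..X}. p ^ k dvd h n})"
      using p h_less by (intro sum_multiplicity_eq_sum_card) (simp_all add: h_def)
    also have "\<dots> \<le> (\<Sum>k\<in>{1..K}. 2 * card {n \<in> {1..X}. p ^ k dvd n} + 2)"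
      unfolding h_def using p E by (intro sum_mono card_quadratic_roots_le) auto
    also have "\<dots> = 2 * (\<Sum>k\<in>{1..K}. card {n \<in> {1..X}. p ^ k dvd n}) + 2 * K"
      by (simp only: sum.distrib sum_distrib_left) simp
    also have "(\<Sum>k\<in>{1..K}. card {n \<in> {1..X}. p ^ k dvd n}) = (\<Sum>n\<in>{1..X}. multiplicity p n)"
      using p n_less by (intro sum_multiplicity_eq_sum_card[symmetric]) simp_all
    also have "\<dots> = multiplicity p (fact X)"
      unfolding fact_prod of_nat_id
      using p by (subst prime_elem_multiplicity_prod_distrib) auto
    finally have "p ^ multiplicity p H \<le> p ^ (2 * multiplicity p (fact X) + 2 * K)"
      using p by (intro power_increasing) (auto simp: Suc_le_eq prime_gt_0_nat)
    also have "\<dots> = (p ^ multiplicity p (fact X)) ^ 2 * (p ^ K) ^ 2"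
      by (simp add: power_add power_mult[symmetric] mult.commute)
    also have "\<dots> \<le> (p ^ multiplicity p (fact X)) ^ 2 * h X ^ 2"
      using K by (intro mult_left_mono power_mono) auto
    finally show ?thesis .
  qed
  have "E ^ X * (fact X) ^ 2 = (\<Prod>n=1..X. E * n\<^sup>2)"
    by (simp add: prod.distrib fact_prod prod_power_distrib)
  also have "\<dots> \<le> H" unfolding H_def h_def by (intro prod_mono) auto
  also have "H = (\<Prod>p\<in>P. p ^ multiplicity p H)"
    using prod_prime_factors[of H] H0 by (simp add: pf)
  also have "\<dots> \<le> (\<Prod>p\<in>P. (p ^ multiplicity p (fact X)) ^ 2 * h X ^ 2)"
    using local_bound by (intro prod_mono) auto
  also have "\<dots> = (\<Prod>p\<in>P. p ^ multiplicity p (fact X)) ^ 2 * h X ^ (2 * card P)"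
    by (simp add: prod.distrib prod_power_distrib power_mult)
  also have "\<dots> \<le> (fact X) ^ 2 * h X ^ (2 * card P)"
    using finP primeP by (intro mult_right_mono power_mono prod_powers_multiplicity_le) auto
  finally have "E ^ X \<le> h X ^ (2 * card P)" by (simp add: mult.commute)
  then show ?thesis by (simp add: h_def P_def)
qed

lemma card_quadratic_primes_ge:
  fixes E X :: nat
  assumes E: "even E" "E \<ge> 3"
  shows "real X \<le> 2 * real (card (quadratic_primes E X)) * ln (1 + real E * real X ^ 2)"
proof -
  have "real (E ^ X) \<le> real ((1 + E * X\<^sup>2) ^ (2 * card (quadratic_primes E X)))"
    using power_le_power_card_quadratic_primes[of E X] E by (simp only: of_nat_le_iff)
  then have "real E ^ X \<le> (1 + real E * real X ^ 2) ^ (2 * card (quadratic_primes E X))"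
    by simp
  then have "ln (real E ^ X) \<le> ln ((1 + real E * real X ^ 2) ^ (2 * card (quadratic_primes E X)))"
    using E by (subst ln_le_cancel_iff) (auto intro!: zero_less_power add_pos_nonneg)
  then have *: "real X * ln (real E) \<le>
      2 * real (card (quadratic_primes E X)) * ln (1 + real E * real X ^ 2)"
    using E by (simp add: ln_realpow add_pos_nonneg)
  have "1 \<le> ln (real E)" using E exp_le by (subst ln_ge_iff) auto
  then have "real X * 1 \<le> real X * ln (real E)" by (intro mult_left_mono) auto
  with * show ?thesis by simp
qed

section \<open>Counting pairs through linear forms modulo primes\<close>

text \<open>Cauchy--Schwarz on the sizes of the fibres of \<open>f\<close>.\<close>

lemma card_collisions_ge:
  fixes f :: "'a \<Rightarrow> 'b"
  assumes A: "finite A" and T: "finite T" "f ` A \<subseteq> T"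
  shows "(real (card A))\<^sup>2 \<le> real (card T) * real (card {(a, b). a \<in> A \<and> b \<in> A \<and> f a = f b})"
proof -
  define F where "F = (\<lambda>t. {a \<in> A. f a = t})"
  have "real (card A) = (\<Sum>t\<in>T. real (card (F t)))"
    using sum.group[OF A T, of "\<lambda>_. 1::nat"] by (simp add: F_def flip: of_nat_sum)
  then have "(real (card A))\<^sup>2 \<le> (\<Sum>t\<in>T. (real (card (F t)))\<^sup>2) * real (card T)"
    using sum_squared_le_sum_of_squares[of "\<lambda>t. real (card (F t))" T] by simp
  also have "(\<Sum>t\<in>T. (real (card (F t)))\<^sup>2) = real (\<Sum>t\<in>T. card (F t \<times> F t))"
    by (simp add: card_cartesian_product power2_eq_square)
  also have "(\<Sum>t\<in>T. card (F t \<times> F t)) = card (\<Union>t\<in>T. F t \<times> F t)"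
    using A T by (intro card_UN_disjoint[symmetric]) (auto simp: F_def)
  also have "(\<Union>t\<in>T. F t \<times> F t) = {(a, b). a \<in> A \<and> b \<in> A \<and> f a = f b}"
    using T by (auto simp: F_def)
  finally show ?thesis by (simp add: mult.commute)
qed

lemma prod_of_bool_eq:
  "finite S \<Longrightarrow> (\<Prod>p\<in>S. of_bool (R p) :: real) = of_bool (\<forall>p\<in>S. R p)"
  by (induction S rule: finite_induct) auto

lemma prod_of_bool_add:
  fixes R S :: "'a \<Rightarrow> bool"
  assumes "finite P"
  shows "(\<Prod>p\<in>P. of_bool (R p) + of_bool (S p) :: real) =
    (\<Sum>T\<in>Pow P. of_bool (\<forall>p\<in>P. if p \<in> T then R p else S p))"
  unfolding prod_add[OF assms]
proof (rule sum.cong)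
  fix T assume T: "T \<in> Pow P"
  then have "finite T" "finite (P - T)" using assms finite_subset by auto
  then have "(\<Prod>p\<in>T. of_bool (R p)) * (\<Prod>p\<in>P - T. of_bool (S p)) =
      (of_bool ((\<forall>p\<in>T. R p) \<and> (\<forall>p\<in>P - T. S p)) :: real)"
    by (simp only: prod_of_bool_eq of_bool_conj)
  also have "((\<forall>p\<in>T. R p) \<and> (\<forall>p\<in>P - T. S p)) = (\<forall>p\<in>P. if p \<in> T then R p else S p)"
    using T by auto
  finally show "(\<Prod>p\<in>T. of_bool (R p)) * (\<Prod>p\<in>P - T. of_bool (S p)) =
      (of_bool (\<forall>p\<in>P. if p \<in> T then R p else S p) :: real)" .
qed simp

lemma sum_of_bool_prod_add:
  assumes "finite P" "finite Z"
  shows "(\<Sum>z\<in>Z. \<Prod>p\<in>P. of_bool (R p z) + of_bool (S p z) :: real) =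
    (\<Sum>T\<in>Pow P. real (card {z \<in> Z. \<forall>p\<in>P. if p \<in> T then R p z else S p z}))"
proof -
  have "(\<Sum>z\<in>Z. \<Prod>p\<in>P. of_bool (R p z) + of_bool (S p z) :: real) =
      (\<Sum>z\<in>Z. \<Sum>T\<in>Pow P. of_bool (\<forall>p\<in>P. if p \<in> T then R p z else S p z))"
    using assms by (simp only: prod_of_bool_add)
  also have "\<dots> = (\<Sum>T\<in>Pow P. \<Sum>z\<in>Z. of_bool (\<forall>p\<in>P. if p \<in> T then R p z else S p z))"
    by (rule sum.swap)
  finally show ?thesis using assms by (simp add: Int_def)
qed

text \<open>Expanding the product turns the sum of the weights into a sum over the choices \<open>T\<close> of a form at each
  prime. For a fixed choice, the condition on \<open>a - b\<close> says that \<open>a\<close> and \<open>b\<close> have the same vector of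
  residues, and there are only \<open>\<Prod>P\<close> such vectors.\<close>

lemma sum_split_weights_ge:
  fixes f g :: "nat \<Rightarrow> int \<times> int \<Rightarrow> int" and A :: "(int \<times> int) set"
  assumes A: "finite A" and P: "finite P" "\<And>p. p \<in> P \<Longrightarrow> p > 0"
    and f: "\<And>p a b. p \<in> P \<Longrightarrow> f p (a - b) = f p a - f p b"
    and g: "\<And>p a b. p \<in> P \<Longrightarrow> g p (a - b) = g p a - g p b"
  shows "2 ^ card P * (real (card A))\<^sup>2 \<le> real (\<Prod>P) *
    (\<Sum>z\<in>A \<times> A. \<Prod>p\<in>P. of_bool (int p dvd f p (fst z - snd z)) +
                          of_bool (int p dvd g p (fst z - snd z)))"
proof -
  let ?R = "\<lambda>T z. \<forall>p\<in>P. if p \<in> T then int p dvd f p (fst z - snd z)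
                          else int p dvd g p (fst z - snd z)"
  have "(real (card A))\<^sup>2 \<le> real (\<Prod>P) * real (card {z \<in> A \<times> A. ?R T z})" for T
  proof -
    define \<phi> where "\<phi> = (\<lambda>a. \<lambda>p\<in>P. (if p \<in> T then f p a else g p a) mod int p)"
    define Y where "Y = (\<Pi>\<^sub>E p\<in>P. {0..<int p})"
    have finY: "finite Y" unfolding Y_def using P by (intro finite_PiE) auto
    have \<phi>: "\<phi> ` A \<subseteq> Y" using P by (auto simp: \<phi>_def Y_def)
    have cardY: "card Y = \<Prod>P" unfolding Y_def using P by (subst card_PiE) auto
    have "\<phi> a = \<phi> b \<longleftrightarrow> ?R T (a, b)" for a b
    proof -
      have "\<phi> a = \<phi> b \<longleftrightarrow> (\<forall>p\<in>P. (if p \<in> T then f p a else g p a) mod int p =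
          (if p \<in> T then f p b else g p b) mod int p)"
        unfolding \<phi>_def by (auto simp: fun_eq_iff restrict_def)
      also have "\<dots> \<longleftrightarrow> ?R T (a, b)"
        using f g by (auto simp: mod_eq_dvd_iff)
      finally show ?thesis .
    qed
    then have "{(a, b). a \<in> A \<and> b \<in> A \<and> \<phi> a = \<phi> b} = {z \<in> A \<times> A. ?R T z}" by auto
    with card_collisions_ge[OF A finY \<phi>] show ?thesis by (simp add: cardY)
  qed
  then have "(\<Sum>T\<in>Pow P. (real (card A))\<^sup>2) \<le>
      (\<Sum>T\<in>Pow P. real (\<Prod>P) * real (card {z \<in> A \<times> A. ?R T z}))"
    by (intro sum_mono)
  then show ?thesis
    using P A by (simp only: sum_of_bool_prod_add finite_cartesian_product sum_distrib_left)
      (simp add: card_Pow)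
qed

lemma card_int_multiples_le:
  fixes d M :: nat
  assumes "d > 0"
  shows "real (card {m \<in> {1..int M}. int d dvd m}) \<le> real M / real d"
proof -
  have "{m \<in> {1..int M}. int d dvd m} \<subseteq> (\<lambda>j. int d * j) ` {1..int (M div d)}"
  proof
    fix m assume m: "m \<in> {m \<in> {1..int M}. int d dvd m}"
    then obtain j where j: "m = int d * j" by auto
    have "0 < int d * j" using m j by simp
    then have "j > 0" using assms by (simp add: zero_less_mult_iff)
    moreover have "j \<le> int M div int d"
      using zdiv_mono1[of m "int M" "int d"] m j assms by simp
    ultimately have "j \<in> {1..int (M div d)}" by (simp add: zdiv_int)
    then show "m \<in> (\<lambda>j. int d * j) ` {1..int (M div d)}" unfolding j by (rule imageI)
  qed
  then have "card {m \<in> {1..int M}. int d dvd m} \<le> card {1..int (M div d)}"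
    by (rule surj_card_le[rotated]) simp
  also have "\<dots> = M div d" by simp
  finally have "real (card {m \<in> {1..int M}. int d dvd m}) \<le> real (M div d)" by simp
  also have "\<dots> \<le> real M / real d" using div_times_less_eq_dividend[of M d] assms
    by (simp add: le_divide_eq flip: of_nat_mult)
  finally show ?thesis .
qed

lemma prod_coprime_dvd:
  fixes h :: "'a \<Rightarrow> int"
  assumes "finite P" "\<And>p. p \<in> P \<Longrightarrow> h p dvd m"
    and "\<And>p q. p \<in> P \<Longrightarrow> q \<in> P \<Longrightarrow> p \<noteq> q \<Longrightarrow> coprime (h p) (h q)"
  shows "prod h P dvd m"
  using assms
proof (induction P rule: finite_induct)
  case (insert p P)
  then have "coprime (h p) (prod h P)" by (intro prod_coprime_right) auto
  with insert show ?case by (simp add: divides_mult)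
qed simp

text \<open>After expansion, the term of \<open>T\<close> counts the \<open>m\<close> divisible by \<open>p\<^sup>2\<close> for \<open>p \<in> T\<close> and by \<open>p\<close> for the other
  primes, hence by the product of these coprime numbers. The upper bound reassembles into a product.\<close>

lemma sum_square_weights_le:
  fixes P :: "nat set" and M :: nat
  assumes P: "finite P" "\<And>p. p \<in> P \<Longrightarrow> prime p"
  shows "(\<Sum>m\<in>{1..int M}. \<Prod>p\<in>P. of_bool (int p ^ 2 dvd m) + of_bool (int p dvd m)) \<le>
    real M * (\<Prod>p\<in>P. 1 / real p ^ 2 + 1 / real p)"
proof -
  let ?R = "\<lambda>T m. \<forall>p\<in>P. if p \<in> T then int p ^ 2 dvd m else int p dvd m"
  have card_le: "real (card {m \<in> {1..int M}. ?R T m}) \<le>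
      real M * ((\<Prod>p\<in>T. 1 / real p ^ 2) * (\<Prod>p\<in>P - T. 1 / real p))" if T: "T \<in> Pow P" for T
  proof -
    define h where "h = (\<lambda>p::nat. if p \<in> T then p ^ 2 else p)"
    have pos: "prod h P > 0" using P by (intro prod_pos) (auto simp: h_def prime_gt_0_nat)
    have cop: "coprime (int (h p)) (int (h q))" if "p \<in> P" "q \<in> P" "p \<noteq> q" for p q
      using primes_coprime[of p q] P(2) that by (auto simp: h_def)
    have "{m \<in> {1..int M}. ?R T m} \<subseteq> {m \<in> {1..int M}. int (prod h P) dvd m}"
    proof
      fix m assume m: "m \<in> {m \<in> {1..int M}. ?R T m}"
      then have "(\<Prod>p\<in>P. int (h p)) dvd m"
        using P(1) cop by (intro prod_coprime_dvd) (auto simp: h_def)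
      with m show "m \<in> {m \<in> {1..int M}. int (prod h P) dvd m}" by simp
    qed
    then have "card {m \<in> {1..int M}. ?R T m} \<le> card {m \<in> {1..int M}. int (prod h P) dvd m}"
      by (intro card_mono finite_subset[OF _ finite_atLeastAtMost_int[of 1 "int M"]]) auto
    then have "real (card {m \<in> {1..int M}. ?R T m}) \<le> real M / real (prod h P)"
      using card_int_multiples_le[OF pos, of M] by linarith
    also have "prod h P = prod h T * prod h (P - T)"
      using T P(1) by (metis PowD mult.commute prod.subset_diff)
    also have "\<dots> = (\<Prod>p\<in>T. p ^ 2) * \<Prod>(P - T)" by (simp add: h_def)
    finally show ?thesis by (simp add: prod_dividef)
  qed
  have "(\<Sum>m\<in>{1..int M}. \<Prod>p\<in>P. of_bool (int p ^ 2 dvd m) + of_bool (int p dvd m)) =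
      (\<Sum>T\<in>Pow P. real (card {m \<in> {1..int M}. ?R T m}))"
    using P(1) by (intro sum_of_bool_prod_add) auto
  also have "\<dots> \<le> (\<Sum>T\<in>Pow P. real M * ((\<Prod>p\<in>T. 1 / real p ^ 2) * (\<Prod>p\<in>P - T. 1 / real p)))"
    by (intro sum_mono card_le)
  also have "\<dots> = real M * (\<Prod>p\<in>P. 1 / real p ^ 2 + 1 / real p)"
    by (simp only: prod_add[OF P(1)] sum_distrib_left)
  finally show ?thesis .
qed

text \<open>The weight \<open>w\<close> of a pair is the number of choices of forms that all vanish on its difference; it is
  a product over the primes and, by \<open>one\<close> and \<open>both\<close>, at most a weight \<open>G\<close> that depends only
  on the value of \<open>q\<close>. The total of \<open>w\<close> over \<open>A \<times> A\<close> is large by \<open>sum_split_weights_ge\<close>; off the diagonal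
  it is at most \<open>B\<close> times the total of \<open>G\<close>. The constant is \<open>p (1/p\<^sup>2 + 1/p) / 2 \<le> 2/3\<close> for
  \<open>p \<ge> 3\<close>.\<close>

lemma card_sq_le_of_split_primes:
  fixes f g :: "nat \<Rightarrow> int \<times> int \<Rightarrow> int" and A :: "(int \<times> int) set"
    and q :: "int \<times> int \<Rightarrow> int"
  assumes A: "finite A"
    and P: "finite P" "\<And>p. p \<in> P \<Longrightarrow> prime p" "\<And>p. p \<in> P \<Longrightarrow> p \<ge> 3"
    and f: "\<And>p a b. p \<in> P \<Longrightarrow> f p (a - b) = f p a - f p b"
    and g: "\<And>p a b. p \<in> P \<Longrightarrow> g p (a - b) = g p a - g p b"
    and one: "\<And>p v. p \<in> P \<Longrightarrow> int p dvd f p v \<or> int p dvd g p v \<Longrightarrow> int p dvd q v"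
    and both: "\<And>p v. p \<in> P \<Longrightarrow> int p dvd f p v \<Longrightarrow> int p dvd g p v \<Longrightarrow> int p ^ 2 dvd q v"
    and range: "\<And>a b. a \<in> A \<Longrightarrow> b \<in> A \<Longrightarrow> a \<noteq> b \<Longrightarrow> q (a - b) \<in> {1..int M}"
    and reps: "\<And>m. m \<ge> 1 \<Longrightarrow>
      real (card {(a, b). a \<in> A \<and> b \<in> A \<and> a \<noteq> b \<and> q (a - b) = m}) \<le> B"
  shows "(real (card A))\<^sup>2 \<le> real (\<Prod>P) * real (card A) + B * real M * (2/3) ^ card P"
proof -
  define w :: "(int \<times> int) \<times> (int \<times> int) \<Rightarrow> real" where
    "w = (\<lambda>z. \<Prod>p\<in>P. of_bool (int p dvd f p (fst z - snd z)) +
                       of_bool (int p dvd g p (fst z - snd z)))"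
  define G :: "int \<Rightarrow> real" where
    "G = (\<lambda>m. \<Prod>p\<in>P. of_bool (int p ^ 2 dvd m) + of_bool (int p dvd m))"
  define D where "D = {z \<in> A \<times> A. fst z = snd z}"
  define Off where "Off = {z \<in> A \<times> A. fst z \<noteq> snd z}"
  have B_nonneg: "B \<ge> 0"
    using reps[of 1] by (meson le_numeral_extra(4) of_nat_0_le_iff order_trans)
  have G_nonneg: "G m \<ge> 0" for m unfolding G_def by (intro prod_nonneg) auto
  have w_le: "w z \<le> G (q (fst z - snd z))" for z
    unfolding w_def G_def using one both by (intro prod_mono) (auto simp: of_bool_def)
  have w_le2: "w z \<le> 2 ^ card P" for z
  proof -
    have "w z \<le> (\<Prod>p\<in>P. 2)" unfolding w_def by (intro prod_mono) (auto simp: of_bool_def)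
    then show ?thesis by simp
  qed
  have "D = (\<lambda>a. (a, a)) ` A" by (auto simp: D_def)
  then have cardD: "card D = card A" by (simp add: card_image inj_on_def)
  have fin_Off: "finite Off" using A by (auto simp: Off_def)
  have "(\<Sum>z\<in>Off. w z) \<le> (\<Sum>z\<in>Off. G (q (fst z - snd z)))" by (intro sum_mono w_le)
  also have "\<dots> = (\<Sum>m\<in>{1..int M}. \<Sum>z\<in>{z \<in> Off. q (fst z - snd z) = m}. G (q (fst z - snd z)))"
    using range fin_Off by (intro sum.group[symmetric]) (auto simp: Off_def)
  also have "\<dots> = (\<Sum>m\<in>{1..int M}. real (card {z \<in> Off. q (fst z - snd z) = m}) * G m)"
    by (intro sum.cong) auto
  also have "\<dots> \<le> (\<Sum>m\<in>{1..int M}. B * G m)"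
  proof (intro sum_mono mult_right_mono G_nonneg)
    fix m assume "m \<in> {1..int M}"
    moreover have "{z \<in> Off. q (fst z - snd z) = m} =
        {(a, b). a \<in> A \<and> b \<in> A \<and> a \<noteq> b \<and> q (a - b) = m}" by (auto simp: Off_def)
    ultimately show "real (card {z \<in> Off. q (fst z - snd z) = m}) \<le> B" using reps[of m] by simp
  qed
  also have "\<dots> = B * (\<Sum>m\<in>{1..int M}. G m)" by (simp add: sum_distrib_left)
  also have "\<dots> \<le> B * (real M * (\<Prod>p\<in>P. 1 / real p ^ 2 + 1 / real p))"
    unfolding G_def using P B_nonneg by (intro mult_left_mono sum_square_weights_le) auto
  finally have off: "(\<Sum>z\<in>Off. w z) \<le> B * (real M * (\<Prod>p\<in>P. 1 / real p ^ 2 + 1 / real p))" .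
  have "(\<Sum>z\<in>A \<times> A. w z) = (\<Sum>z\<in>D. w z) + (\<Sum>z\<in>Off. w z)"
    using A by (subst sum.union_disjoint[symmetric]) (auto simp: D_def Off_def intro!: sum.cong)
  also have "(\<Sum>z\<in>D. w z) \<le> real (card A) * 2 ^ card P"
    using sum_bounded_above[of D w, OF w_le2] by (simp add: cardD)
  finally have total: "(\<Sum>z\<in>A \<times> A. w z) \<le>
      real (card A) * 2 ^ card P + B * (real M * (\<Prod>p\<in>P. 1 / real p ^ 2 + 1 / real p))"
    using off by linarith
  have "2 ^ card P * (real (card A))\<^sup>2 \<le> real (\<Prod>P) * (\<Sum>z\<in>A \<times> A. w z)"
    unfolding w_def using A P f g by (intro sum_split_weights_ge) (auto simp: prime_gt_0_nat)
  also have "\<dots> \<le> real (\<Prod>P) *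
      (real (card A) * 2 ^ card P + B * (real M * (\<Prod>p\<in>P. 1 / real p ^ 2 + 1 / real p)))"
    by (intro mult_left_mono total) (simp add: prod_nonneg)
  also have "\<dots> = 2 ^ card P * (real (\<Prod>P) * real (card A) +
      B * real M * ((\<Prod>p\<in>P. real p) * (\<Prod>p\<in>P. 1 / real p ^ 2 + 1 / real p) * (1/2) ^ card P))"
    by (simp add: algebra_simps power_divide)
  also have "(\<Prod>p\<in>P. real p) * (\<Prod>p\<in>P. 1 / real p ^ 2 + 1 / real p) * (1/2) ^ card P =
      (\<Prod>p\<in>P. real p * (1 / real p ^ 2 + 1 / real p) * (1/2))"
    by (simp only: prod.distrib prod_constant)
  finally have main: "(real (card A))\<^sup>2 \<le> real (\<Prod>P) * real (card A) +
      B * real M * (\<Prod>p\<in>P. real p * (1 / real p ^ 2 + 1 / real p) * (1/2))" by simp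
  have "(\<Prod>p\<in>P. real p * (1 / real p ^ 2 + 1 / real p) * (1/2)) \<le> (\<Prod>p\<in>P. 2/3)"
  proof (intro prod_mono conjI)
    fix p assume "p \<in> P"
    then have "real p \<ge> 3" using P(3) by fastforce
    then show "real p * (1 / real p ^ 2 + 1 / real p) * (1/2) \<le> 2/3"
      by (simp add: field_simps power2_eq_square)
  qed auto
  moreover have "B * real M \<ge> 0"
    using B_nonneg by simp
  ultimately have "B * real M * (\<Prod>p\<in>P. real p * (1 / real p ^ 2 + 1 / real p) * (1/2)) \<le>
      B * real M * (2/3) ^ card P" by (intro mult_left_mono) auto
  with main show ?thesis by linarith
qed

section \<open>Splitting of the form modulo primes\<close>

lemma pos_def_bqf_coeffs:
  assumes "pos_def_bqf \<alpha> \<beta> \<gamma>"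
  shows "\<alpha> > 0" "\<beta>\<^sup>2 - 4 * \<alpha> * \<gamma> < 0"
proof -
  have "bqf \<alpha> \<beta> \<gamma> (1::real, 0) > 0"
    using assms unfolding pos_def_bqf_def by (auto simp: zero_prod_def)
  then show \<alpha>: "\<alpha> > 0" by (simp add: bqf_def)
  have "bqf \<alpha> \<beta> \<gamma> (real_of_int \<beta>, - 2 * real_of_int \<alpha>) > 0"
    using assms \<alpha> unfolding pos_def_bqf_def by (auto simp: zero_prod_def)
  also have "bqf \<alpha> \<beta> \<gamma> (real_of_int \<beta>, - 2 * real_of_int \<alpha>) =
      real_of_int (\<alpha> * (4 * \<alpha> * \<gamma> - \<beta>\<^sup>2))"
    by (simp add: bqf_def algebra_simps power2_eq_square)
  finally show "\<beta>\<^sup>2 - 4 * \<alpha> * \<gamma> < 0"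
    using \<alpha> by (simp only: of_int_0_less_iff zero_less_mult_iff) auto
qed

lemma pos_def_bqf_int_pos:
  fixes v :: "int \<times> int"
  assumes "pos_def_bqf \<alpha> \<beta> \<gamma>" "v \<noteq> 0"
  shows "bqf \<alpha> \<beta> \<gamma> v > 0"
proof -
  have "bqf \<alpha> \<beta> \<gamma> (real_of_int (fst v), real_of_int (snd v)) > 0"
    using assms unfolding pos_def_bqf_def by (auto simp: zero_prod_def prod_eq_iff)
  also have "bqf \<alpha> \<beta> \<gamma> (real_of_int (fst v), real_of_int (snd v)) = real_of_int (bqf \<alpha> \<beta> \<gamma> v)"
    by (simp add: bqf_def)
  finally show ?thesis by simp
qed

lemma bqf_grid_diff_le:
  assumes "a \<in> grid N" "b \<in> grid N"
  shows "bqf \<alpha> \<beta> \<gamma> (a - b) \<le> (\<bar>\<alpha>\<bar> + \<bar>\<beta>\<bar> + \<bar>\<gamma>\<bar>) * (int N)\<^sup>2"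
proof -
  define x y where "x = fst (a - b)" and "y = snd (a - b)"
  have x: "\<bar>x\<bar> \<le> int N" and y: "\<bar>y\<bar> \<le> int N"
    using assms by (auto simp: grid_def x_def y_def)
  have *: "\<bar>u * v\<bar> \<le> (int N)\<^sup>2" if "\<bar>u\<bar> \<le> int N" "\<bar>v\<bar> \<le> int N" for u v
    unfolding power2_eq_square abs_mult using that by (intro mult_mono) auto
  have **: "c * z \<le> \<bar>c\<bar> * (int N)\<^sup>2" if "\<bar>z\<bar> \<le> (int N)\<^sup>2" for c z
  proof -
    have "c * z \<le> \<bar>c\<bar> * \<bar>z\<bar>" by (metis abs_ge_self abs_mult)
    also have "\<dots> \<le> \<bar>c\<bar> * (int N)\<^sup>2" using that by (intro mult_left_mono) auto
    finally show ?thesis .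
  qed
  have "bqf \<alpha> \<beta> \<gamma> (a - b) = \<alpha> * (x * x) + \<beta> * (x * y) + \<gamma> * (y * y)"
    by (simp add: bqf_def x_def y_def power2_eq_square mult.assoc)
  also have "\<dots> \<le> \<bar>\<alpha>\<bar> * (int N)\<^sup>2 + \<bar>\<beta>\<bar> * (int N)\<^sup>2 + \<bar>\<gamma>\<bar> * (int N)\<^sup>2"
    using x y by (intro add_mono ** *)
  finally show ?thesis by (simp add: algebra_simps)
qed

text \<open>Write \<open>t = 2\<alpha>n\<close>, so that \<open>D t\<^sup>2 = 1\<close> modulo \<open>p\<close> and \<open>D t\<close> is a square root of \<open>D\<close>. Then
  \<open>4\<alpha>Q(x,y) = (2\<alpha>x + \<beta>y)\<^sup>2 - D y\<^sup>2\<close> factors as \<open>f g\<close> modulo \<open>p\<close>. Having \<open>\<alpha>\<close> and \<open>2\<close> inside the square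
  makes them units modulo \<open>p\<close>, like \<open>D\<close> and \<open>n\<close>; hence \<open>f\<close> and \<open>g\<close> are independent, and if both vanish
  then \<open>p\<close> divides \<open>x\<close> and \<open>y\<close>.\<close>

lemma bqf_splits_mod_prime:
  fixes \<alpha> \<beta> \<gamma> D n p x y :: int
  assumes p: "prime p" and D: "D = \<beta>\<^sup>2 - 4 * \<alpha> * \<gamma>" and root: "p dvd 1 - D * (2 * \<alpha> * n)\<^sup>2"
  defines "f \<equiv> 2 * \<alpha> * x + (\<beta> + D * (2 * \<alpha> * n)) * y"
    and "g \<equiv> 2 * \<alpha> * x + (\<beta> - D * (2 * \<alpha> * n)) * y"
  shows "p dvd f \<or> p dvd g \<Longrightarrow> p dvd \<alpha> * x\<^sup>2 + \<beta> * x * y + \<gamma> * y\<^sup>2"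
    and "p dvd f \<Longrightarrow> p dvd g \<Longrightarrow> p\<^sup>2 dvd \<alpha> * x\<^sup>2 + \<beta> * x * y + \<gamma> * y\<^sup>2"
proof -
  let ?Q = "\<alpha> * x\<^sup>2 + \<beta> * x * y + \<gamma> * y\<^sup>2"
  have unit: "\<not> p dvd z" if "z dvd D * (2 * \<alpha> * n)\<^sup>2" for z
  proof
    assume "p dvd z"
    then have "p dvd D * (2 * \<alpha> * n)\<^sup>2" using that dvd_trans by blast
    from dvd_add[OF root this] have "p dvd 1" by simp
    with p show False by (simp add: not_prime_unit)
  qed
  have "\<not> p dvd 2" "\<not> p dvd \<alpha>" "\<not> p dvd D" "\<not> p dvd n"
    by (rule unit; simp add: power2_eq_square)+
  note nd = this
  {
    assume "p dvd f \<or> p dvd g"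
    then have "p dvd f * g" by auto
    moreover have "f * g = 2 * (2 * (\<alpha> * ?Q)) + D * y\<^sup>2 * (1 - D * (2 * \<alpha> * n)\<^sup>2)"
      unfolding f_def g_def D by (simp add: algebra_simps power2_eq_square)
    ultimately have "p dvd 2 * (2 * (\<alpha> * ?Q))"
      using root by (metis dvd_add_left_iff dvd_mult)
    then show "p dvd ?Q" using nd(1,2) p by (metis prime_dvd_mult_iff)
  next
    assume fg: "p dvd f" "p dvd g"
    have "f - g = 2 * (2 * (D * (\<alpha> * (n * y))))"
      unfolding f_def g_def by (simp add: algebra_simps)
    with dvd_diff[OF fg] have "p dvd y" using nd p by (metis prime_dvd_mult_iff)
    moreover from this fg(1) have "p dvd 2 * (\<alpha> * x)"
      unfolding f_def by (simp add: dvd_add_left_iff mult.assoc)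
    then have "p dvd x" using nd p by (metis prime_dvd_mult_iff)
    ultimately show "p\<^sup>2 dvd ?Q"
      by (auto simp: power2_eq_square algebra_simps elim!: dvdE intro!: dvd_add)
  }
qed

section \<open>The bound for the size of the set\<close>

lemma le_add_sqrt_of_sq_le:
  fixes x q Y :: real
  assumes "x\<^sup>2 \<le> q * x + Y" "x \<ge> 0" "q \<ge> 0" "Y \<ge> 0"
  shows "x \<le> q + sqrt Y"
proof (cases "x \<le> q")
  case True
  then show ?thesis using assms by (smt (verit) real_sqrt_ge_zero)
next
  case False
  have "(x - q)\<^sup>2 \<le> x * (x - q)"
    unfolding power2_eq_square using False assms by (intro mult_right_mono) auto
  also have "\<dots> \<le> Y" using assms by (simp add: algebra_simps power2_eq_square)
  finally have "x - q \<le> sqrt Y" by (rule real_le_rsqrt)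
  then show ?thesis by simp
qed

text \<open>The primes come from \<open>1 + E n\<^sup>2\<close> with \<open>n \<le> L = \<lfloor>ln N\<rfloor>\<close>, so each is at most \<open>h = 1 + E L\<^sup>2\<close>. Taking
  \<open>k\<close> of them with \<open>k \<approx> L / (2 ln h)\<close> is possible by \<open>card_quadratic_primes_ge\<close>, and keeps their
  product at most \<open>h\<^sup>k \<le> exp (L/2) \<le> sqrt N\<close>. The factor \<open>1/6\<close> comes from
  \<open>sqrt ((2/3)\<^sup>k) \<le> exp (- k/6)\<close>.\<close>

lemma card_le_of_rep_count_le:
  assumes pd: "pos_def_bqf \<alpha> \<beta> \<gamma>"
  obtains E C :: real where "E > 0" "C > 0"
    "\<And>N A B. N \<ge> 3 \<Longrightarrow> B \<ge> 1 \<Longrightarrow> A \<subseteq> grid N \<Longrightarrow>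
       (\<And>m. m \<ge> 1 \<Longrightarrow> real (rep_count \<alpha> \<beta> \<gamma> A m) \<le> B) \<Longrightarrow>
       real (card A) \<le> exp (ln (real N) / 2) + sqrt C * sqrt B * real N *
         exp (- (((ln (real N) - 1) / (2 * ln (1 + E * (ln (real N))\<^sup>2)) - 1) / 6))"
proof -
  define D where "D = \<beta>\<^sup>2 - 4 * \<alpha> * \<gamma>"
  have \<alpha>: "\<alpha> > 0" and D: "D < 0" using pos_def_bqf_coeffs[OF pd] by (simp_all add: D_def)
  define E where "E = nat (- D * (2 * \<alpha>)\<^sup>2)"
  have E_int: "int E = - D * (2 * \<alpha>)\<^sup>2" using D by (simp add: E_def mult_nonpos_nonneg)
  have "(- D * \<alpha>\<^sup>2) > 0" using D \<alpha> by (intro mult_pos_pos) auto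
  moreover have E4: "int E = 4 * (- D * \<alpha>\<^sup>2)" by (simp add: E_int power_mult_distrib)
  ultimately have E_ge: "E \<ge> 4" by linarith
  have "even (int E)" unfolding E4 by simp
  then have E_even: "even E" by simp
  define C where "C = nat (\<bar>\<alpha>\<bar> + \<bar>\<beta>\<bar> + \<bar>\<gamma>\<bar>)"
  have C_int: "int C = \<bar>\<alpha>\<bar> + \<bar>\<beta>\<bar> + \<bar>\<gamma>\<bar>" by (simp add: C_def)
  have "int C > 0" using \<alpha> by (simp add: C_int)
  then have C_pos: "C > 0" by simp
  show ?thesis
  proof (rule that[of "real E" "real C"])
    show "real E > 0" "real C > 0" using E_ge C_pos by auto
    fix N :: nat and A :: "(int \<times> int) set" and B :: real
    assume N: "N \<ge> 3" and B: "B \<ge> 1" and A: "A \<subseteq> grid N"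
      and reps: "\<And>m. m \<ge> 1 \<Longrightarrow> real (rep_count \<alpha> \<beta> \<gamma> A m) \<le> B"
    \<comment> \<open>\<open>N \<ge> 3 > e\<close> ensures \<open>L \<ge> 1\<close>, hence \<open>h > 1\<close> and \<open>ln h > 0\<close>.\<close>
    define L where "L = nat \<lfloor>ln (real N)\<rfloor>"
    have "ln (real N) \<ge> 1" using N exp_le by (subst ln_ge_iff) auto
    then have L: "real L \<le> ln (real N)" "real L \<ge> ln (real N) - 1" "L \<ge> 1"
      unfolding L_def by linarith+
    define h where "h = 1 + real E * (real L)\<^sup>2"
    have "real E * (real L)\<^sup>2 \<ge> 4 * 1" using E_ge L by (intro mult_mono) auto
    then have h: "h > 1" by (simp add: h_def)
    then have ln_h: "ln h > 0" by simp
    define k where "k = nat \<lfloor>real L / (2 * ln h)\<rfloor>"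
    have "real L / (2 * ln h) \<ge> 0" using ln_h by simp
    then have k: "real k \<le> real L / (2 * ln h)" "real k \<ge> real L / (2 * ln h) - 1"
      unfolding k_def by linarith+
    have "real L \<le> real (card (quadratic_primes E L)) * (2 * ln h)"
      using card_quadratic_primes_ge[OF E_even, of L] E_ge by (simp add: h_def mult_ac)
    then have "real L / (2 * ln h) \<le> real (card (quadratic_primes E L))"
      using ln_h by (simp add: divide_le_eq)
    with k have "k \<le> card (quadratic_primes E L)" by linarith
    then obtain P where P: "P \<subseteq> quadratic_primes E L" "card P = k" "finite P"
      by (rule obtain_subset_with_card_n)
    have primeP: "prime p" if "p \<in> P" for p using that P by (auto simp: quadratic_primes_def)
    have "\<exists>n. p dvd 1 + E * n\<^sup>2" if "p \<in> P" for p
      using that P by (auto simp: quadratic_primes_def)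
    then obtain \<nu> where \<nu>: "\<And>p. p \<in> P \<Longrightarrow> p dvd 1 + E * (\<nu> p)\<^sup>2" by metis
    have ge3: "p \<ge> 3" if "p \<in> P" for p
    proof -
      have "p \<noteq> 2" using \<nu>[OF that] E_even by auto
      with prime_ge_2_nat[OF primeP[OF that]] show ?thesis by linarith
    qed
    have root: "int p dvd 1 - D * (2 * \<alpha> * int (\<nu> p))\<^sup>2" if "p \<in> P" for p
    proof -
      have "int p dvd int (1 + E * (\<nu> p)\<^sup>2)" using \<nu>[OF that] by (simp only: int_dvd_int_iff)
      also have "\<dots> = 1 - D * (2 * \<alpha> * int (\<nu> p))\<^sup>2"
        by (simp add: E_int power_mult_distrib)
      finally show ?thesis .
    qed
    define f where "f = (\<lambda>(p::nat) (v::int \<times> int).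
      2 * \<alpha> * fst v + (\<beta> + D * (2 * \<alpha> * int (\<nu> p))) * snd v)"
    define g where "g = (\<lambda>(p::nat) (v::int \<times> int).
      2 * \<alpha> * fst v + (\<beta> - D * (2 * \<alpha> * int (\<nu> p))) * snd v)"
    have finA: "finite A" using A by (rule finite_subset) (simp add: grid_def)
    have "(real (card A))\<^sup>2 \<le>
        real (\<Prod>P) * real (card A) + B * real (C * N\<^sup>2) * (2/3) ^ card P"
    proof (rule card_sq_le_of_split_primes[where f = f and g = g and q = "bqf \<alpha> \<beta> \<gamma>"])
      fix p v assume p: "p \<in> P"
      have ip: "prime (int p)" using primeP[OF p] by simp
      note split = bqf_splits_mod_prime[OF ip D_def root[OF p], of "fst v" "snd v"]
      have bqf: "bqf \<alpha> \<beta> \<gamma> v = \<alpha> * (fst v)\<^sup>2 + \<beta> * fst v * snd v + \<gamma> * (snd v)\<^sup>2"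
        by (simp add: bqf_def)
      show "int p dvd bqf \<alpha> \<beta> \<gamma> v" if "int p dvd f p v \<or> int p dvd g p v"
        using split(1) that unfolding f_def g_def bqf by simp
      show "(int p)\<^sup>2 dvd bqf \<alpha> \<beta> \<gamma> v" if "int p dvd f p v" "int p dvd g p v"
        using split(2) that unfolding f_def g_def bqf by simp
    next
      fix a b assume ab: "a \<in> A" "b \<in> A" "a \<noteq> b"
      then have "bqf \<alpha> \<beta> \<gamma> (a - b) > 0" using pd by (intro pos_def_bqf_int_pos) auto
      moreover have "bqf \<alpha> \<beta> \<gamma> (a - b) \<le> int (C * N\<^sup>2)"
        using bqf_grid_diff_le[of a N b \<alpha> \<beta> \<gamma>] ab A by (auto simp: C_int)
      ultimately show "bqf \<alpha> \<beta> \<gamma> (a - b) \<in> {1..int (C * N\<^sup>2)}" by simp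
    next
      show "real (card {(a, b). a \<in> A \<and> b \<in> A \<and> a \<noteq> b \<and> bqf \<alpha> \<beta> \<gamma> (a - b) = m}) \<le> B"
        if "m \<ge> 1" for m using reps[OF that] by (simp add: rep_count_def)
    qed (use finA P primeP ge3 in \<open>auto simp: f_def g_def algebra_simps\<close>)
    then have card_le: "real (card A) \<le>
        real (\<Prod>P) + sqrt (B * real (C * N\<^sup>2) * (2/3) ^ k)"
      using B P by (intro le_add_sqrt_of_sq_le) (auto simp: prod_nonneg)
    have "real (\<Prod>P) \<le> exp (ln (real N) / 2)"
    proof -
      have "real (\<Prod>P) = (\<Prod>p\<in>P. real p)" by simp
      also have "\<dots> \<le> (\<Prod>p\<in>P. h)"
      proof (intro prod_mono conjI)
        fix p assume "p \<in> P"
        then have "p \<le> 1 + E * L\<^sup>2" using P quadratic_primes_le by blast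
        then have "real p \<le> real (1 + E * L\<^sup>2)" by (simp only: of_nat_le_iff)
        then show "real p \<le> h" by (simp add: h_def)
      qed simp
      also have "\<dots> = exp (real k * ln h)" using h P by (simp add: exp_of_nat_mult)
      also have "real k * ln h \<le> ln (real N) / 2"
        using k(1) L(1) ln_h by (simp add: field_simps)
      finally show ?thesis by simp
    qed
    moreover have "sqrt (B * real (C * N\<^sup>2) * (2/3) ^ k) \<le> sqrt (real C) * sqrt B * real N *
         exp (- (((ln (real N) - 1) / (2 * ln (1 + real E * (ln (real N))\<^sup>2)) - 1) / 6))"
    proof -
      define u where "u = (ln (real N) - 1) / (2 * ln (1 + real E * (ln (real N))\<^sup>2)) - 1"
      have "(2/3::real) \<le> exp (- (1/3))" using exp_ge_add_one_self[of "-(1/3)"] by simp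
      then have "(2/3::real) ^ k \<le> exp (- (1/3)) ^ k" by (intro power_mono) auto
      also have "\<dots> = exp (- (real k / 3))" by (simp flip: exp_of_nat_mult)
      also have "\<dots> \<le> exp (- (u / 3))"
      proof -
        have "h \<le> 1 + real E * (ln (real N))\<^sup>2"
          unfolding h_def using L by (intro add_left_mono mult_left_mono power_mono) auto
        then have "ln h \<le> ln (1 + real E * (ln (real N))\<^sup>2)" using h by simp
        then have "(ln (real N) - 1) / (2 * ln (1 + real E * (ln (real N))\<^sup>2)) \<le> real L / (2 * ln h)"
          using L ln_h by (intro frac_le) auto
        with k(2) have "u \<le> real k" by (simp add: u_def)
        then show ?thesis by simp
      qed
      also have "\<dots> = exp (- (u / 6)) ^ 2" by (simp flip: exp_double)
      finally have "(2/3::real) ^ k \<le> exp (- (u / 6)) ^ 2" .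
      then have "sqrt (B * real (C * N\<^sup>2) * (2/3) ^ k) \<le> 
          sqrt (B * real (C * N\<^sup>2) * exp (- (u / 6)) ^ 2)"
        using B by (intro real_sqrt_le_mono mult_left_mono) auto
      also have "\<dots> = sqrt (real C) * sqrt B * real N * exp (- (u / 6))"
        by (simp add: real_sqrt_mult)
      finally show ?thesis by (simp add: u_def)
    qed
    ultimately show "real (card A) \<le> exp (ln (real N) / 2) + sqrt (real C) * sqrt B * real N *
         exp (- (((ln (real N) - 1) / (2 * ln (1 + real E * (ln (real N))\<^sup>2)) - 1) / 6))"
      using card_le by linarith
  qed
qed

lemma card_grid_subset_le:
  assumes "A \<subseteq> grid N"
  shows "real (card A) \<le> real N * real N"
proof -
  have "card A \<le> card (grid N)" using assms by (intro card_mono) (auto simp: grid_def)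
  also have "\<dots> = N * N" by (simp add: grid_def card_cartesian_product)
  finally show ?thesis by (metis of_nat_le_iff of_nat_mult)
qed

text \<open>The exponent in \<open>card_le_of_rep_count_le\<close> is asymptotic to \<open>ln N / (24 ln ln N)\<close>, so every
  \<open>c < 1/24\<close> works for large \<open>N\<close>; the finitely many smaller \<open>N\<close> are absorbed into the constant
  through the trivial bound \<open>|A| \<le> N\<^sup>2\<close>.\<close>

theorem theorem1p5:
  fixes \<alpha> \<beta> \<gamma> :: int
  assumes "primitive_bqf \<alpha> \<beta> \<gamma>"
    and "pos_def_bqf \<alpha> \<beta> \<gamma>"
  shows "\<exists>c::real. c > 0 \<and> (\<exists>C::real. C > 0 \<and>
    (\<forall>(N::nat) (B::real) (A::(int \<times> int) set).
       N \<ge> 3 \<longrightarrow> B \<ge> 1 \<longrightarrow> A \<subseteq> grid N \<longrightarrow>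
       (\<forall>m::int. m \<ge> 1 \<longrightarrow> real (rep_count \<alpha> \<beta> \<gamma> A m) \<le> B) \<longrightarrow>
       real (card A) \<le> C * sqrt B * real N * exp (- c * (ln (real N) / ln (ln (real N))))))"
proof -
  obtain E C where E: "E > 0" and C: "C > 0" and bound:
    "\<And>N A B. N \<ge> 3 \<Longrightarrow> B \<ge> 1 \<Longrightarrow> A \<subseteq> grid N \<Longrightarrow>
       (\<And>m. m \<ge> 1 \<Longrightarrow> real (rep_count \<alpha> \<beta> \<gamma> A m) \<le> B) \<Longrightarrow>
       real (card A) \<le> exp (ln (real N) / 2) + sqrt C * sqrt B * real N *
         exp (- (((ln (real N) - 1) / (2 * ln (1 + E * (ln (real N))\<^sup>2)) - 1) / 6))"
    using card_le_of_rep_count_le[OF assms(2)] by blast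
  define \<phi> where "\<phi> = (\<lambda>N::nat. 1 / 30 * (ln (real N) / ln (ln (real N))))"
  have "eventually (\<lambda>N::nat. \<phi> N \<le> ln (real N) / 2) at_top"
    unfolding \<phi>_def by real_asymp
  moreover have "eventually (\<lambda>N::nat. \<phi> N \<le>
      ((ln (real N) - 1) / (2 * ln (1 + E * (ln (real N))\<^sup>2)) - 1) / 6) at_top"
    unfolding \<phi>_def using E by real_asymp
  ultimately have "eventually (\<lambda>N::nat. \<phi> N \<le> ln (real N) / 2 \<and> \<phi> N \<le>
      ((ln (real N) - 1) / (2 * ln (1 + E * (ln (real N))\<^sup>2)) - 1) / 6) at_top"
    by (rule eventually_conj)
  then obtain N0 where N0: "\<And>N. N \<ge> N0 \<Longrightarrow> \<phi> N \<le> ln (real N) / 2"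
      "\<And>N. N \<ge> N0 \<Longrightarrow> \<phi> N \<le> ((ln (real N) - 1) / (2 * ln (1 + E * (ln (real N))\<^sup>2)) - 1) / 6"
    by (auto simp: eventually_at_top_linorder)
  \<comment> \<open>The sum covers every small \<open>N\<close> at once, as each of its terms is nonnegative.\<close>
  define K where "K = (1 + sqrt C) + (\<Sum>N<N0. real N * exp (\<phi> N))"
  have S_nonneg: "(\<Sum>N<N0. real N * exp (\<phi> N)) \<ge> 0" by (intro sum_nonneg) auto
  have sC: "sqrt C > 0" using C by simp
  have "real (card A) \<le> K * sqrt B * real N * exp (- \<phi> N)"
    if N: "N \<ge> 3" and B: "B \<ge> 1" and A: "A \<subseteq> grid N"
      and reps: "\<And>m. m \<ge> 1 \<Longrightarrow> real (rep_count \<alpha> \<beta> \<gamma> A m) \<le> B" for N B A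
  proof -
    have sB: "sqrt B \<ge> 1" using B by simp
    obtain K' where K': "K' \<le> K" "K' \<ge> 0" "real (card A) \<le> K' * sqrt B * real N * exp (- \<phi> N)"
    proof (cases "N < N0")
      case True
      have "real (card A) \<le> real N * real N" using A by (rule card_grid_subset_le)
      also have "\<dots> = (real N * exp (\<phi> N)) * 1 * real N * exp (- \<phi> N)"
        by (simp add: exp_minus)
      also have "\<dots> \<le> (real N * exp (\<phi> N)) * sqrt B * real N * exp (- \<phi> N)"
        using sB by (intro mult_right_mono mult_left_mono) auto
      finally have "real (card A) \<le> (real N * exp (\<phi> N)) * sqrt B * real N * exp (- \<phi> N)" .
      moreover have "real N * exp (\<phi> N) \<le> (\<Sum>N<N0. real N * exp (\<phi> N))"
        using True by (intro member_le_sum) auto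
      then have "real N * exp (\<phi> N) \<le> K" using sC unfolding K_def by linarith
      ultimately show ?thesis by (intro that) auto
    next
      case False
      then have "N \<ge> N0" by simp
      note asym = N0[OF this]
      have "exp (ln (real N) / 2) = real N * exp (- (ln (real N) / 2))"
      proof -
        have "real N = exp (ln (real N))" using N by simp
        then have "real N * exp (- (ln (real N) / 2)) = exp (ln (real N) - ln (real N) / 2)"
          by (metis exp_add diff_conv_add_uminus)
        then show ?thesis by simp
      qed
      also have "\<dots> = 1 * real N * exp (- (ln (real N) / 2))" by simp
      also have "\<dots> \<le> sqrt B * real N * exp (- \<phi> N)"
        using sB asym(1) by (intro mult_mono) auto
      finally have 1: "exp (ln (real N) / 2) \<le> sqrt B * real N * exp (- \<phi> N)" .
      have 2: "sqrt C * sqrt B * real N *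
          exp (- (((ln (real N) - 1) / (2 * ln (1 + E * (ln (real N))\<^sup>2)) - 1) / 6)) \<le>
          sqrt C * sqrt B * real N * exp (- \<phi> N)"
        using asym(2) B C by (intro mult_left_mono) auto
      have "real (card A) \<le> sqrt B * real N * exp (- \<phi> N) + sqrt C * sqrt B * real N * exp (- \<phi> N)"
        using bound[OF N B A reps] 1 2 by linarith
      then show ?thesis
        using S_nonneg sC by (intro that[of "1 + sqrt C"]) (auto simp: K_def algebra_simps)
    qed
    have "K' * sqrt B * real N * exp (- \<phi> N) \<le> K * sqrt B * real N * exp (- \<phi> N)"
      using K' B by (intro mult_right_mono) auto
    with K' show ?thesis by linarith
  qed
  moreover have "K > 0" using S_nonneg sC unfolding K_def by linarith
  ultimately show ?thesis
    unfolding \<phi>_def by (intro exI[of _ "1/30"] conjI exI[of _ K]) auto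
qed

end
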